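(* Let $n \geq 1$ and let $x_1, \dots, x_n \in [0,1]$ (not necessarily distinct). For $x \in [0,1]$ define $$E(x) = W_2\left( \frac{1}{n+1} \sum_{k=1}^{n} \delta_{x_k} + \frac{\delta_{x}}{n+1},\ dx\right), \qquad F(x) = (n+1)x^2 - x - 2 \sum_{k=1}^{n} \max\{x_k, x\}.$$ Then a point $z \in [0,1]$ is a global minimizer of $E$ on $[0,1]$ if and only if it is a global minimizer of $F$ on $[0,1]$. Consequently, any sequence $(x_k)_{k=1}^\infty$ in $[0,1]$ in which, from some index $n_0$ on, each $x_{n+1}$ ($n \geq n_0$) is chosen as a global minimizer of the corresponding $E$ (greedy $W_2$ minimization) is a Kritzinger sequence, i.e. each such $x_{n+1}$ is a global minimizer of the corresponding $F$.
   Context: $dx$ denotes Lebesgue measure on $[0,1]$ and $W_2$ the quadratic Wasserstein distance. For ordered points $0 \le a_1 \le \dots \le a_m \le 1$ one has $W_2\left(\frac1m\sum_{k=1}^m \delta_{a_k}, dx\right)^2 = \sum_{i=1}^m \int_{(i-1)/m}^{i/m} (x-a_i)^2\,dx$. A Kritzinger sequence is a sequence in $[0,1]$ which starts with an arbitrary finite initial set $x_1,\dots,x_{n_0}$ and is then extended greedily: for every $n \geq n_0$, given $x_1,\dots,x_n$, the point $x_{n+1}$ is a global minimizer on $[0,1]$ of $F(x) = (n+1)x^2 - x - 2\sum_{k=1}^n \max\{x_k,x\}$. *)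

theory Defs
  imports "HOL-Probability.Probability"
begin

definition couplings :: "'a measure \<Rightarrow> 'b measure \<Rightarrow> ('a \<times> 'b) measure set" where
  "couplings M N =
     {\<pi>. sets \<pi> = sets (M \<Otimes>\<^sub>M N) \<and> distr \<pi> M fst = M \<and> distr \<pi> N snd = N}"

text \<open>
  The infimum is taken in the extended nonnegative reals. The final conversion to a real number
  is meaningful for probability measures with finite second moment, where the infimum is finite.
  All measures below are probability measures supported in $[0,1]$.
\<close>

definition W2 :: "'a::metric_space measure \<Rightarrow> 'a measure \<Rightarrow> real" where
  "W2 M N = sqrt (enn2real
     (INF \<pi>\<in>couplings M N. \<integral>\<^sup>+ (x, y). ennreal ((dist x y)\<^sup>2) \<partial>\<pi>))"

text \<open>Lebesgue measure on $[0,1]$, as a Borel measure on the real line.\<close>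

definition unit_lebesgue :: "real measure" where
  "unit_lebesgue = density lborel (indicator {0..1})"

text \<open>
  Sequences are functions on the natural numbers whose values at indices \<open>k \<ge> 1\<close> are used.
  The Dirac measure at a point \<open>a\<close> is \<open>return borel a\<close>. The argument of \<open>measure_of\<close> below is
  countably additive by \<open>emeasure_extended_empirical\<close>.
\<close>

definition extended_empirical :: "nat \<Rightarrow> (nat \<Rightarrow> real) \<Rightarrow> real \<Rightarrow> real measure" where
  "extended_empirical n x z = measure_of UNIV (sets borel)
     (\<lambda>A. (1 / of_nat (n + 1)) * (\<Sum>k=1..n. emeasure (return borel (x k)) A)
           + emeasure (return borel z) A / of_nat (n + 1))"

definition greedy_energy :: "nat \<Rightarrow> (nat \<Rightarrow> real) \<Rightarrow> real \<Rightarrow> real" where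
  "greedy_energy n x z = W2 (extended_empirical n x z) unit_lebesgue"

definition kritzinger_fun :: "nat \<Rightarrow> (nat \<Rightarrow> real) \<Rightarrow> real \<Rightarrow> real" where
  "kritzinger_fun n x z = real (n + 1) * z\<^sup>2 - z - 2 * (\<Sum>k=1..n. max (x k) z)"

definition global_minimizer :: "(real \<Rightarrow> real) \<Rightarrow> real \<Rightarrow> bool" where
  "global_minimizer f z \<longleftrightarrow> is_arg_min f (\<lambda>y. y \<in> {0..1}) z"

definition kritzinger_from :: "nat \<Rightarrow> (nat \<Rightarrow> real) \<Rightarrow> bool" where
  "kritzinger_from n0 x \<longleftrightarrow> (\<forall>k\<ge>1. x k \<in> {0..1}) \<and>
     (\<forall>n\<ge>n0. global_minimizer (kritzinger_fun n x) (x (n + 1)))"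

definition greedy_W2_from :: "nat \<Rightarrow> (nat \<Rightarrow> real) \<Rightarrow> bool" where
  "greedy_W2_from n0 x \<longleftrightarrow> (\<forall>k\<ge>1. x k \<in> {0..1}) \<and>
     (\<forall>n\<ge>n0. global_minimizer (greedy_energy n x) (x (n + 1)))"

definition kritzinger_sequence :: "(nat \<Rightarrow> real) \<Rightarrow> bool" where
  "kritzinger_sequence x \<longleftrightarrow> (\<exists>n0\<ge>1. kritzinger_from n0 x)"

lemma space_extended_empirical [simp]: "space (extended_empirical n x z) = UNIV"
  by (simp add: extended_empirical_def space_measure_of_conv)

lemma sets_extended_empirical [simp, measurable_cong]:
  "sets (extended_empirical n x z) = sets borel"
  using sets.sigma_sets_eq[of "borel :: real measure"]
  by (simp add: extended_empirical_def sets_measure_of_conv)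

lemma emeasure_extended_empirical:
  assumes "A \<in> sets borel"
  shows "emeasure (extended_empirical n x z) A =
    (1 / of_nat (n + 1)) * (\<Sum>k=1..n. emeasure (return borel (x k)) A)
      + emeasure (return borel z) A / of_nat (n + 1)"
proof (rule emeasure_measure_of[OF extended_empirical_def])
  let ?f = "\<lambda>A. (1 / of_nat (n + 1)) * (\<Sum>k=1..n. emeasure (return borel (x k)) A)
      + emeasure (return borel z) A / of_nat (n + 1) :: ennreal"
  show "positive (sets (extended_empirical n x z)) ?f"
    by (simp add: positive_def)
  show "countably_additive (sets (extended_empirical n x z)) ?f"
  proof (rule countably_additiveI)
    fix B :: "nat \<Rightarrow> real set"
    assume B: "range B \<subseteq> sets (extended_empirical n x z)" "disjoint_family B"
    have s: "(\<Sum>i. emeasure (return borel a) (B i)) = emeasure (return borel a) (\<Union> (range B))"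
      for a :: real
      using B by (intro suminf_emeasure) auto
    have "(\<Sum>i. ?f (B i)) =
        (1 / of_nat (n + 1)) * (\<Sum>i. \<Sum>k=1..n. emeasure (return borel (x k)) (B i))
        + (\<Sum>i. emeasure (return borel z) (B i)) / of_nat (n + 1)"
      by (subst suminf_add[symmetric]) (auto simp: ennreal_suminf_cmult ennreal_suminf_divide)
    also have "(\<Sum>i. \<Sum>k=1..n. emeasure (return borel (x k)) (B i)) =
        (\<Sum>k=1..n. \<Sum>i. emeasure (return borel (x k)) (B i))"
      by (rule suminf_sum) auto
    finally show "(\<Sum>i. ?f (B i)) = ?f (\<Union> (range B))"
      by (simp only: s)
  qed
qed (use assms in auto)

lemma prob_space_extended_empirical: "prob_space (extended_empirical n x z)"
proof
  have "emeasure (extended_empirical n x z) UNIV = of_nat (n + 1) / (of_nat (n + 1) :: ennreal)"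
    by (simp add: emeasure_extended_empirical emeasure_return add_divide_distrib_ennreal
        ennreal_times_divide mult.commute add.commute)
  also have "\<dots> = 1"
    by (intro ennreal_divide_self) (auto simp: of_nat_less_top simp del: of_nat_Suc)
  finally show "emeasure (extended_empirical n x z) (space (extended_empirical n x z)) = 1"
    by simp
qed

lemma prob_space_unit_lebesgue: "prob_space unit_lebesgue"
  by (rule prob_spaceI) (simp add: unit_lebesgue_def emeasure_density)

end

theory Submission
  imports Defs
begin

text \<open>
  For a probability measure on the unit interval with distribution function \<open>F\<close>, the squared distance
  to Lebesgue measure is the second moment minus \<open>2/3\<close> plus the integral of \<open>F\<^sup>2\<close>, by Kantorovich
  duality with the quantile coupling as the optimal one. For atoms \<open>a\<^sub>1, \<dots>, a\<^sub>m\<close> of mass \<open>1/m\<close> the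
  integral of \<open>F\<^sup>2\<close> is one minus the mean of \<open>max a\<^sub>i a\<^sub>j\<close> over all pairs, so no sorting of the atoms
  is needed. With \<open>m = n + 1\<close> and \<open>z\<close> as the last atom, the terms involving \<open>z\<close> add up to the
  Kritzinger functional divided by \<open>(n + 1)\<^sup>2\<close>.
\<close>

section \<open>Kantorovich duality with an attaining coupling\<close>

text \<open>Weak duality: the integral of \<open>f (fst p) + g (snd p)\<close> depends only on the
  marginals, so it bounds the cost of every coupling from below, and \<open>\<pi>0\<close> attains
  the bound. The inequality is asked only almost everywhere, so that potentials valid on the unit
  square suffice.\<close>

lemma W2_eq_dual:
  fixes M N :: "'a::metric_space measure"
  assumes f: "integrable M f" and g: "integrable N g"
    and le: "\<And>\<pi>. \<pi> \<in> couplings M N \<Longrightarrow> AE p in \<pi>. f (fst p) + g (snd p) \<le> (dist (fst p) (snd p))\<^sup>2"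
    and \<pi>0: "\<pi>0 \<in> couplings M N"
    and eq: "AE p in \<pi>0. f (fst p) + g (snd p) = (dist (fst p) (snd p))\<^sup>2"
  shows "(W2 M N)\<^sup>2 = (\<integral>x. f x \<partial>M) + (\<integral>y. g y \<partial>N)"
proof -
  define h where "h = (\<lambda>p. f (fst p) + g (snd p))"
  have h: "integrable \<pi> h \<and> (\<integral>p. h p \<partial>\<pi>) = (\<integral>x. f x \<partial>M) + (\<integral>y. g y \<partial>N)"
    if \<pi>: "\<pi> \<in> couplings M N" for \<pi>
  proof -
    have sets: "sets \<pi> = sets (M \<Otimes>\<^sub>M N)" and 1: "distr \<pi> M fst = M" and 2: "distr \<pi> N snd = N"
      using \<pi> by (auto simp: couplings_def)
    have m: "fst \<in> \<pi> \<rightarrow>\<^sub>M M" "snd \<in> \<pi> \<rightarrow>\<^sub>M N"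
      unfolding measurable_cong_sets[OF sets refl] by (rule measurable_fst measurable_snd)+
    have "integrable \<pi> (\<lambda>p. f (fst p))" "integrable \<pi> (\<lambda>p. g (snd p))"
      using integrable_distr[OF m(1), of f] integrable_distr[OF m(2), of g] f g 1 2 by simp_all
    moreover have "(\<integral>p. f (fst p) \<partial>\<pi>) = (\<integral>x. f x \<partial>M)" "(\<integral>p. g (snd p) \<partial>\<pi>) = (\<integral>x. g x \<partial>N)"
      using integral_distr[OF m(1), of f] integral_distr[OF m(2), of g] f g 1 2
      by (simp_all add: borel_measurable_integrable)
    ultimately show ?thesis by (simp add: h_def)
  qed
  define L where "L = (\<integral>x. f x \<partial>M) + (\<integral>y. g y \<partial>N)"
  have h0: "AE p in \<pi>0. 0 \<le> h p"
    using eq by eventually_elim (simp add: h_def)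
  have attained: "(\<integral>\<^sup>+(x, y). ennreal ((dist x y)\<^sup>2) \<partial>\<pi>0) = ennreal L"
  proof -
    have "(\<integral>\<^sup>+(x, y). ennreal ((dist x y)\<^sup>2) \<partial>\<pi>0) = (\<integral>\<^sup>+p. ennreal (h p) \<partial>\<pi>0)"
      by (rule nn_integral_cong_AE, use eq in eventually_elim) (auto simp: h_def split_beta)
    also have "\<dots> = ennreal L"
      using nn_integral_eq_integral[OF _ h0] h[OF \<pi>0] by (simp add: L_def)
    finally show ?thesis .
  qed
  have lower: "ennreal L \<le> (\<integral>\<^sup>+(x, y). ennreal ((dist x y)\<^sup>2) \<partial>\<pi>)"
    if \<pi>: "\<pi> \<in> couplings M N" for \<pi>
  proof -
    \<comment> \<open>Under a coupling other than \<open>\<pi>0\<close>, \<open>h\<close> may be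
      negative and \<open>ennreal\<close> would truncate it. Its positive part is still dominated by
      the cost, which is nonnegative.\<close>
    have "L \<le> (\<integral>p. max 0 (h p) \<partial>\<pi>)"
      using h[OF \<pi>] integral_mono[of \<pi> h "\<lambda>p. max 0 (h p)"] by (simp add: L_def)
    then have "ennreal L \<le> (\<integral>\<^sup>+p. ennreal (max 0 (h p)) \<partial>\<pi>)"
      using h[OF \<pi>] by (subst nn_integral_eq_integral) (auto intro: ennreal_leI)
    also have "\<dots> \<le> (\<integral>\<^sup>+(x, y). ennreal ((dist x y)\<^sup>2) \<partial>\<pi>)"
      by (rule nn_integral_mono_AE, use le[OF \<pi>] in eventually_elim)
        (auto simp: h_def split_beta intro!: ennreal_leI)
    finally show ?thesis .
  qed
  have "(INF \<pi>\<in>couplings M N. \<integral>\<^sup>+ (x, y). ennreal ((dist x y)\<^sup>2) \<partial>\<pi>) = ennreal L"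
    by (rule antisym; (rule INF_lower2[OF \<pi>0], rule eq_refl, rule attained)?)
      (rule INF_greatest, rule lower)
  \<comment> \<open>\<open>enn2real (ennreal L)\<close> returns \<open>L\<close> only for
    nonnegative \<open>L\<close>.\<close>
  moreover have "0 \<le> L"
    using integral_nonneg_AE[OF h0] h[OF \<pi>0] by (simp add: L_def)
  ultimately show ?thesis
    by (simp add: W2_def L_def)
qed

section \<open>Integration over the unit interval\<close>

lemma sets_unit_lebesgue [simp, measurable_cong]: "sets unit_lebesgue = sets borel"
  by (simp add: unit_lebesgue_def)

lemma space_unit_lebesgue [simp]: "space unit_lebesgue = UNIV"
  by (simp add: unit_lebesgue_def)

text \<open>The endpoints are null; they are dropped because quantiles are characterised only at
  levels strictly between 0 and 1.\<close>

lemma AE_unit_lebesgue: "AE y in unit_lebesgue. 0 < y \<and> y < 1"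
proof -
  have "AE y in lborel. y \<noteq> (0::real)" "AE y in lborel. y \<noteq> (1::real)"
    by (rule AE_lborel_singleton)+
  then show ?thesis
    unfolding unit_lebesgue_def by (subst AE_density) (auto simp: indicator_def)
qed

text \<open>Meant for integrands with a kink or a jump, such as a positive part or an indicator,
  that follow a continuous \<open>f'\<close> on one subinterval and vanish on the rest of the unit
  interval.\<close>

lemma integral_unit_lebesgue_FTC:
  fixes f F :: "real \<Rightarrow> real"
  assumes "f \<in> borel_measurable borel"
    and "\<And>y. 0 \<le> y \<Longrightarrow> y \<le> 1 \<Longrightarrow> f y = indicator {a..b} y * f' y"
    and "0 \<le> a" "a \<le> b" "b \<le> 1"
    and "\<And>y. (F has_real_derivative f' y) (at y)" "continuous_on UNIV f'"
  shows "(\<integral>y. f y \<partial>unit_lebesgue) = F b - F a"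
proof -
  have "(\<integral>y. f y \<partial>unit_lebesgue) = (\<integral>y. indicator {0..1} y * f y \<partial>lborel)"
    unfolding unit_lebesgue_def
    by (subst integral_real_density[symmetric]) (use assms in \<open>auto simp: ennreal_indicator\<close>)
  also have "\<dots> = (\<integral>y. f' y * indicator {a..b} y \<partial>lborel)"
    using assms by (intro Bochner_Integration.integral_cong) (auto simp: indicator_def)
  also have "\<dots> = F b - F a"
    using assms by (intro integral_FTC_Icc_real) (auto simp: continuous_on_eq_continuous_at)
  finally show ?thesis .
qed

lemma integral_unit_lebesgue_power2: "(\<integral>y. y\<^sup>2 \<partial>unit_lebesgue) = 1/3"
  by (subst integral_unit_lebesgue_FTC[where a=0 and b=1 and f'="\<lambda>y. y\<^sup>2" and F="\<lambda>y. y^3/3"])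
    (auto intro!: derivative_eq_intros continuous_intros)

lemma integral_unit_lebesgue_pos_part:
  assumes "0 \<le> c" "c \<le> 1"
  shows "(\<integral>y. max (y - c) 0 \<partial>unit_lebesgue) = (1 - c)\<^sup>2 / 2"
  by (subst integral_unit_lebesgue_FTC[where a=c and b=1 and f'="\<lambda>y. y - c" and F="\<lambda>y. (y - c)\<^sup>2/2"])
    (use assms in \<open>auto intro!: derivative_eq_intros continuous_intros simp: indicator_def\<close>)

lemma measure_unit_lebesgue_atLeast:
  assumes "0 \<le> c" "c \<le> 1"
  shows "measure unit_lebesgue {c..} = 1 - c"
proof -
  have "(\<integral>y. indicator {c..} y \<partial>unit_lebesgue) = 1 - c"
    by (subst integral_unit_lebesgue_FTC[where a=c and b=1 and f'="\<lambda>y. 1" and F="\<lambda>y. y"])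
      (use assms in \<open>auto intro!: derivative_eq_intros continuous_intros simp: indicator_def\<close>)
  then show ?thesis by simp
qed

lemma measure_unit_lebesgue_lessThan:
  assumes "0 \<le> c" "c \<le> 1"
  shows "measure unit_lebesgue {..<c} = c"
proof -
  interpret prob_space unit_lebesgue by (rule prob_space_unit_lebesgue)
  have "{..<c} = UNIV - {c..}" by auto
  then show ?thesis
    using prob_compl[of "{c..}"] measure_unit_lebesgue_atLeast[OF assms] by simp
qed

text \<open>The quantile transform lives on the open interval; losing two null points does not
  change the measure. This gives the second marginal of the quantile coupling.\<close>

lemma distr_unit_interval_id:
  "distr (restrict_space lborel {0<..<1}) borel (\<lambda>y. y) = unit_lebesgue"
proof (rule measure_eqI)
  fix A assume "A \<in> sets (distr (restrict_space lborel {0<..<1}) borel (\<lambda>y::real. y))"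
  then have A [measurable]: "A \<in> sets borel" by simp
  have "emeasure (distr (restrict_space lborel {0<..<1}) borel (\<lambda>y. y)) A = emeasure lborel (A \<inter> {0<..<1})"
    by (subst emeasure_distr)
      (auto simp: space_restrict_space emeasure_restrict_space measurable_restrict_space1 Int_commute)
  also have "\<dots> = emeasure lborel (A \<inter> {0..1})"
  proof (rule emeasure_eq_AE)
    have "AE y in lborel. y \<noteq> (0::real)" "AE y in lborel. y \<noteq> (1::real)"
      by (rule AE_lborel_singleton)+
    then show "AE x in lborel. (x \<in> A \<inter> {0<..<1}) = (x \<in> A \<inter> {0..1})"
      by eventually_elim auto
  qed auto
  also have "\<dots> = emeasure unit_lebesgue A"
    unfolding unit_lebesgue_def
    by (subst emeasure_density) (auto simp: indicator_inter_arith[symmetric] Int_commute)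
  finally show "emeasure (distr (restrict_space lborel {0<..<1}) borel (\<lambda>y. y)) A = emeasure unit_lebesgue A" .
qed simp

section \<open>Distance to Lebesgue measure in terms of the distribution function\<close>

text \<open>
  The dual potentials come from integrating
  \<open>y 1[s < x] \<le> F(s) 1[s < x] + max (y - F(s)) 0\<close> over \<open>s\<close> in the unit interval, which bounds
  \<open>x y\<close> by a function of \<open>x\<close> plus a function of \<open>y\<close>. Equality holds if \<open>s < x\<close> is equivalent to
  \<open>F(s) < y\<close> for all \<open>s\<close>, which characterises \<open>x\<close> as the quantile of \<open>y\<close>.
\<close>

lemma W2_unit_lebesgue:
  assumes "real_distribution M" and M01: "AE x in M. x \<in> {0..1}"
  shows "(W2 M unit_lebesgue)\<^sup>2 =
    (\<integral>x. x\<^sup>2 \<partial>M) - 2/3 + (\<integral>s. (cdf M s)\<^sup>2 \<partial>unit_lebesgue)"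
proof -
  interpret M: cdf_distribution M
    using assms(1) by (simp add: cdf_distribution_def)
  interpret U: prob_space unit_lebesgue by (rule prob_space_unit_lebesgue)
  interpret MU: pair_prob_space M unit_lebesgue ..
  interpret UU: pair_prob_space unit_lebesgue unit_lebesgue ..
  define F where "F = cdf M"
  \<comment> \<open>\<open>M.I\<close> is the quantile function, the generalised inverse of
    \<open>F\<close>.\<close>
  define Q where "Q = M.I"
  have F_meas [measurable]: "F \<in> borel_measurable borel" by (simp add: F_def)
  have F01: "0 \<le> F s" "F s \<le> 1" for s by (simp_all add: F_def M.cdf_nonneg M.cdf_bounded_prob)
  have sM [simp]: "space M = UNIV" using sets_eq_imp_space_eq[OF M.events_eq_borel] by simp

  \<comment> \<open>Dual potentials and their pointwise inequality\<close>
  define \<phi> where "\<phi> = (\<lambda>x. \<integral>s. F s * indicator {..<x} s \<partial>unit_lebesgue)"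
  define \<psi> where "\<psi> = (\<lambda>y. \<integral>s. max (y - F s) 0 \<partial>unit_lebesgue)"
  have [measurable]: "\<phi> \<in> borel_measurable borel" "\<psi> \<in> borel_measurable borel"
    unfolding \<phi>_def \<psi>_def lessThan_def by measurable
  have F_int: "integrable unit_lebesgue (\<lambda>s. F s * indicator {..<x} s)" for x
    using F01 by (intro U.integrable_const_bound[of _ 1]) (auto simp: indicator_def)
  have pos01: "0 \<le> max (y - F s) 0 \<and> max (y - F s) 0 \<le> 1" if "0 \<le> y" "y \<le> 1" for y s
    using F01(1)[of s] that by auto
  have pos_int: "integrable unit_lebesgue (\<lambda>s. max (y - F s) 0)" if "0 \<le> y" "y \<le> 1" for y
    using pos01[OF that] by (intro U.integrable_const_bound[of _ 1]) auto

  have xy: "x * y = (\<integral>s. y * indicator {..<x} s \<partial>unit_lebesgue)" if "x \<in> {0..1}" for x y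
    using that by (simp add: measure_unit_lebesgue_lessThan)
  have sum: "\<phi> x + \<psi> y = (\<integral>s. F s * indicator {..<x} s + max (y - F s) 0 \<partial>unit_lebesgue)"
    if "0 < y" "y < 1" for x y
    using that F_int pos_int by (simp add: \<phi>_def \<psi>_def)
  have dual_le: "x * y \<le> \<phi> x + \<psi> y" if "x \<in> {0..1}" "0 < y" "y < 1" for x y
    unfolding xy[OF that(1)] sum[OF that(2,3)]
    by (intro integral_mono Bochner_Integration.integrable_add F_int pos_int)
      (use that in \<open>auto simp: indicator_def intro!: U.integrable_const_bound[of _ 1]\<close>)
  \<comment> \<open>Where \<open>s < x\<close>, also \<open>F s < y\<close>, and the integrand is
    \<open>F s + (y - F s)\<close>; elsewhere both of its terms vanish.\<close>
  have dual_eq: "x * y = \<phi> x + \<psi> y"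
    if "x \<in> {0..1}" "0 < y" "y < 1" "\<And>s. y \<le> F s \<longleftrightarrow> x \<le> s" for x y
    unfolding xy[OF that(1)] sum[OF that(2,3)]
    using that(4) by (intro Bochner_Integration.integral_cong) (auto simp: indicator_def not_le[symmetric])

  \<comment> \<open>Integrability of the potentials and of the squares\<close>
  have \<phi>01: "0 \<le> \<phi> x" "\<phi> x \<le> 1" for x
    unfolding \<phi>_def using F01
    by (intro integral_nonneg_AE U.integral_le_const F_int AE_I2; simp add: indicator_def)+
  have \<psi>01: "0 \<le> \<psi> y \<and> \<psi> y \<le> 1" if "0 \<le> y" "y \<le> 1" for y
    unfolding \<psi>_def using pos01[OF that] pos_int[OF that]
    by (intro conjI integral_nonneg_AE U.integral_le_const AE_I2) auto
  have int_\<phi>: "integrable M \<phi>"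
    using \<phi>01 by (intro M.integrable_const_bound[of _ 1]) auto
  have int_\<psi>: "integrable unit_lebesgue \<psi>"
  proof (rule U.integrable_const_bound)
    show "AE y in unit_lebesgue. norm (\<psi> y) \<le> 1"
      using AE_unit_lebesgue by eventually_elim (use \<psi>01 in force)
  qed simp
  have sq_le: "x\<^sup>2 \<le> 1" if "0 \<le> x" "x \<le> 1" for x :: real
    using that by (simp add: power_le_one)
  have int_M: "integrable M (\<lambda>x. x\<^sup>2)"
  proof (rule M.integrable_const_bound)
    show "AE x in M. norm (x\<^sup>2) \<le> 1"
      using M01 by eventually_elim (auto intro: sq_le)
  qed simp
  have int_U: "integrable unit_lebesgue (\<lambda>x. x\<^sup>2)"
  proof (rule U.integrable_const_bound)
    show "AE x in unit_lebesgue. norm (x\<^sup>2) \<le> 1"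
      using AE_unit_lebesgue by eventually_elim (auto intro: sq_le)
  qed simp

  \<comment> \<open>Integrals of the potentials in terms of \<open>F\<close>\<close>
  have tail: "measure M {s<..} = 1 - F s" for s
  proof -
    have "{s<..} = UNIV - {..s}" by auto
    then show ?thesis
      using M.prob_compl[of "{..s}"] by (simp add: F_def cdf_def)
  qed
  have "(\<integral>x. \<phi> x \<partial>M) = (\<integral>s. \<integral>x. F s * indicator {..<x} s \<partial>M \<partial>unit_lebesgue)"
    unfolding \<phi>_def
  proof (rule MU.Fubini_integral[symmetric])
    show "integrable (M \<Otimes>\<^sub>M unit_lebesgue) (\<lambda>(x, s). F s * indicator {..<x} s)"
      unfolding lessThan_def
      by (rule MU.P.integrable_const_bound[of _ 1]) (use F01 in \<open>auto simp: indicator_def\<close>)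
  qed
  \<comment> \<open>Read as a function of \<open>x\<close>, the indicator is that of
    \<open>{s<..}\<close>, whose mass is given by \<open>tail\<close>.\<close>
  also have "\<dots> = (\<integral>s. \<integral>x. F s * indicator {s<..} x \<partial>M \<partial>unit_lebesgue)"
    by (intro Bochner_Integration.integral_cong) (auto simp: indicator_def)
  also have "\<dots> = (\<integral>s. F s * (1 - F s) \<partial>unit_lebesgue)"
    by (simp add: tail)
  finally have I\<phi>: "(\<integral>x. \<phi> x \<partial>M) = (\<integral>s. F s * (1 - F s) \<partial>unit_lebesgue)" .

  have "(\<integral>y. \<psi> y \<partial>unit_lebesgue) = (\<integral>s. \<integral>y. max (y - F s) 0 \<partial>unit_lebesgue \<partial>unit_lebesgue)"
    unfolding \<psi>_def
  proof (rule UU.Fubini_integral[symmetric])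
    \<comment> \<open>The bound by 1 may fail for \<open>y\<close> outside the unit interval, so it
      is only available almost everywhere.\<close>
    have "AE p in unit_lebesgue \<Otimes>\<^sub>M unit_lebesgue. 0 < fst p \<and> fst p < 1"
    proof (rule UU.AE_pair_measure)
      show "AE x in unit_lebesgue. AE y in unit_lebesgue. 0 < fst (x, y) \<and> fst (x, y) < 1"
        using AE_unit_lebesgue by eventually_elim simp
    qed measurable
    then have "AE p in unit_lebesgue \<Otimes>\<^sub>M unit_lebesgue. norm (case p of (y, s) \<Rightarrow> max (y - F s) 0) \<le> 1"
      by eventually_elim (use pos01 in force)
    then show "integrable (unit_lebesgue \<Otimes>\<^sub>M unit_lebesgue) (\<lambda>(y, s). max (y - F s) 0)"
      by (rule UU.P.integrable_const_bound) simp
  qed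
  then have I\<psi>: "(\<integral>y. \<psi> y \<partial>unit_lebesgue) = (\<integral>s. (1 - F s)\<^sup>2 / 2 \<partial>unit_lebesgue)"
    by (simp add: integral_unit_lebesgue_pos_part F01)

  \<comment> \<open>The quantile coupling and its optimality\<close>
  let ?\<Omega> = "restrict_space lborel {0<..<1::real}"
  \<comment> \<open>Inverse transform sampling: \<open>Q\<close> pushes Lebesgue measure on the open
    interval to \<open>M\<close>, which gives the first marginal.\<close>
  define \<pi>0 where "\<pi>0 = distr ?\<Omega> (M \<Otimes>\<^sub>M unit_lebesgue) (\<lambda>y. (Q y, y))"
  have Q_meas [measurable]: "Q \<in> ?\<Omega> \<rightarrow>\<^sub>M borel"
    using M.measurable_CI unfolding Q_def
    by (simp cong: measurable_cong_sets add: measurable_cong_sets[OF sets_restrict_space_cong[OF sets_lborel] refl])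
  have Q_meas' [measurable]: "(\<lambda>y. (Q y, y)) \<in> ?\<Omega> \<rightarrow>\<^sub>M M \<Otimes>\<^sub>M unit_lebesgue"
    by (intro measurable_Pair Q_meas[simplified measurable_cong_sets[OF refl M.events_eq_borel[symmetric]]])
      (auto intro: measurable_restrict_space1)
  have fst0: "distr \<pi>0 M fst = M"
  proof -
    have "distr \<pi>0 M fst = distr ?\<Omega> M Q"
      unfolding \<pi>0_def by (subst distr_distr) (auto simp: comp_def)
    also have "\<dots> = distr ?\<Omega> borel Q" by (rule distr_cong) auto
    finally show ?thesis using M.distr_I_eq_M by (simp add: Q_def)
  qed
  have snd0: "distr \<pi>0 unit_lebesgue snd = unit_lebesgue"
  proof -
    have "distr \<pi>0 unit_lebesgue snd = distr ?\<Omega> unit_lebesgue (\<lambda>y. y)"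
      unfolding \<pi>0_def by (subst distr_distr) (auto simp: comp_def)
    also have "\<dots> = distr ?\<Omega> borel (\<lambda>y. y)" by (rule distr_cong) auto
    finally show ?thesis by (simp add: distr_unit_interval_id)
  qed
  have \<pi>0: "\<pi>0 \<in> couplings M unit_lebesgue"
    using fst0 snd0 by (simp add: couplings_def) (simp add: \<pi>0_def)

  have marg: "AE p in \<pi>. fst p \<in> {0..1} \<and> 0 < snd p \<and> snd p < 1"
    if \<pi>: "\<pi> \<in> couplings M unit_lebesgue" for \<pi>
  proof -
    have sets: "sets \<pi> = sets (M \<Otimes>\<^sub>M unit_lebesgue)"
      and 1: "distr \<pi> M fst = M" and 2: "distr \<pi> unit_lebesgue snd = unit_lebesgue"
      using \<pi> by (auto simp: couplings_def)
    have m: "fst \<in> \<pi> \<rightarrow>\<^sub>M M" "snd \<in> \<pi> \<rightarrow>\<^sub>M unit_lebesgue"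
      unfolding measurable_cong_sets[OF sets refl] by (rule measurable_fst measurable_snd)+
    have "AE p in \<pi>. fst p \<in> {0..1}"
      using M01 AE_distrD[OF m(1), of "\<lambda>x. x \<in> {0..1}"] by (simp only: 1)
    moreover have "AE p in \<pi>. 0 < snd p \<and> snd p < 1"
      using AE_unit_lebesgue AE_distrD[OF m(2), of "\<lambda>y. 0 < y \<and> y < 1"] by (simp only: 2)
    ultimately show ?thesis by eventually_elim simp
  qed
  have attained: "AE p in \<pi>0. fst p * snd p = \<phi> (fst p) + \<psi> (snd p)"
  proof -
    have "AE p in \<pi>0. fst p \<in> {0..1}"
      using marg[OF \<pi>0] by eventually_elim simp
    from AE_distrD[OF Q_meas' this[unfolded \<pi>0_def]] have "AE y in ?\<Omega>. Q y \<in> {0..1}"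
      by simp
    then have "AE y in ?\<Omega>. Q y * y = \<phi> (Q y) + \<psi> y"
      using AE_space
    proof eventually_elim
      case (elim y)
      then have y: "0 < y" "y < 1" by (auto simp: space_restrict_space)
      \<comment> \<open>\<open>M.pseudoinverse\<close> says that \<open>y \<le> F s\<close> iff
        \<open>Q y \<le> s\<close>, exactly the equality condition of
        \<open>dual_eq\<close>.\<close>
      show ?case
        unfolding F_def Q_def by (rule dual_eq[OF elim(1) y, unfolded F_def Q_def], rule M.pseudoinverse[OF y])
    qed
    moreover have "{p \<in> space (M \<Otimes>\<^sub>M unit_lebesgue). fst p * snd p = \<phi> (fst p) + \<psi> (snd p)}
        \<in> sets (M \<Otimes>\<^sub>M unit_lebesgue)"
      by measurable
    ultimately show ?thesis
      unfolding \<pi>0_def by (simp only: AE_distr_iff[OF Q_meas'] fst_conv snd_conv)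
  qed

  \<comment> \<open>Expanding \<open>(x - y)\<^sup>2\<close> turns the upper bound on
    \<open>x * y\<close> into a lower bound on the cost, with these potentials.\<close>
  have "(W2 M unit_lebesgue)\<^sup>2 =
      (\<integral>x. x\<^sup>2 - 2 * \<phi> x \<partial>M) + (\<integral>y. y\<^sup>2 - 2 * \<psi> y \<partial>unit_lebesgue)"
  proof (rule W2_eq_dual[OF _ _ _ \<pi>0])
    show "AE p in \<pi>. (fst p)\<^sup>2 - 2 * \<phi> (fst p) + ((snd p)\<^sup>2 - 2 * \<psi> (snd p)) \<le> (dist (fst p) (snd p))\<^sup>2"
      if "\<pi> \<in> couplings M unit_lebesgue" for \<pi>
      using marg[OF that]
    proof eventually_elim
      case (elim p)
      then show ?case using dual_le[of "fst p" "snd p"] by (simp add: dist_real_def power2_diff)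
    qed
    show "AE p in \<pi>0. (fst p)\<^sup>2 - 2 * \<phi> (fst p) + ((snd p)\<^sup>2 - 2 * \<psi> (snd p)) = (dist (fst p) (snd p))\<^sup>2"
      using attained by eventually_elim (simp add: dist_real_def power2_diff)
  qed (use int_M int_U int_\<phi> int_\<psi> in auto)
  also have "\<dots> = (\<integral>x. x\<^sup>2 \<partial>M) + 1/3 - (2 * (\<integral>s. F s * (1 - F s) \<partial>unit_lebesgue) + 2 * (\<integral>s. (1 - F s)\<^sup>2 / 2 \<partial>unit_lebesgue))"
    using int_M int_U int_\<phi> int_\<psi> by (simp add: I\<phi> I\<psi> integral_unit_lebesgue_power2)
  also have "2 * (\<integral>s. F s * (1 - F s) \<partial>unit_lebesgue) + 2 * (\<integral>s. (1 - F s)\<^sup>2 / 2 \<partial>unit_lebesgue)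
      = (\<integral>s. 1 - (F s)\<^sup>2 \<partial>unit_lebesgue)"
  proof -
    have i: "integrable unit_lebesgue (\<lambda>s. F s * (1 - F s))" "integrable unit_lebesgue (\<lambda>s. (1 - F s)\<^sup>2 / 2)"
    proof -
      have bd: "\<bar>F s * (1 - F s)\<bar> \<le> 1" "\<bar>(1 - F s)\<^sup>2 / 2\<bar> \<le> 1" for s
        using F01[of s] power_le_one[of "1 - F s" 2] by (simp_all add: mult_le_one)
      show "integrable unit_lebesgue (\<lambda>s. F s * (1 - F s))" "integrable unit_lebesgue (\<lambda>s. (1 - F s)\<^sup>2 / 2)"
        by (rule U.integrable_const_bound[of _ 1], use bd in simp, measurable)+
    qed
    \<comment> \<open>Pointwise,
      \<open>2 * F * (1 - F) + (1 - F)\<^sup>2 = 1 - F\<^sup>2\<close>.\<close>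
    have "(\<integral>s. 1 - (F s)\<^sup>2 \<partial>unit_lebesgue) = (\<integral>s. 2 * (F s * (1 - F s)) + 2 * ((1 - F s)\<^sup>2 / 2) \<partial>unit_lebesgue)"
      by (intro Bochner_Integration.integral_cong) (auto simp: power2_eq_square field_simps)
    also have "\<dots> = 2 * (\<integral>s. F s * (1 - F s) \<partial>unit_lebesgue) + 2 * (\<integral>s. (1 - F s)\<^sup>2 / 2 \<partial>unit_lebesgue)"
      by (subst Bochner_Integration.integral_add[OF integrable_mult_right[OF i(1)] integrable_mult_right[OF i(2)]])
        (simp only: integral_mult_right_zero)
    finally show ?thesis by simp
  qed
  also have "(\<integral>s. 1 - (F s)\<^sup>2 \<partial>unit_lebesgue) = 1 - (\<integral>s. (F s)\<^sup>2 \<partial>unit_lebesgue)"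
  proof -
    have "integrable unit_lebesgue (\<lambda>s. (F s)\<^sup>2)"
      by (rule U.integrable_const_bound[of _ 1], simp add: sq_le F01, measurable)
    then show ?thesis
      using U.prob_space by (subst Bochner_Integration.integral_diff) auto
  qed
  finally show ?thesis by (simp add: F_def)
qed

section \<open>Extended empirical measures\<close>

text \<open>A uniformly drawn index, with \<open>z\<close> in slot \<open>n + 1\<close>, selects the
  atom. Drawing indices rather than points handles repeated points and reduces integrals to finite
  sums.\<close>

lemma extended_empirical_eq_distr:
  "extended_empirical n x z =
    distr (measure_pmf (pmf_of_set {1..n+1})) borel (x(n+1 := z))"
proof (rule measure_eqI)
  fix A assume "A \<in> sets (extended_empirical n x z)"
  then have A: "A \<in> sets borel" by simp
  let ?a = "x(n+1 := z)"
  have "emeasure (distr (measure_pmf (pmf_of_set {1..n+1})) borel ?a) A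
      = (\<Sum>k=1..n+1. indicator A (?a k)) / of_nat (n + 1)"
    using A
    by (subst nn_integral_indicator[symmetric], simp, subst nn_integral_distr)
      (simp_all add: nn_integral_pmf_of_set)
  then show "emeasure (extended_empirical n x z) A =
      emeasure (distr (measure_pmf (pmf_of_set {1..n+1})) borel ?a) A"
    using A by (simp add: emeasure_extended_empirical divide_ennreal_def distrib_left distrib_right mult.commute)
qed simp

lemma integral_extended_empirical:
  fixes h :: "real \<Rightarrow> real"
  assumes "h \<in> borel_measurable borel"
  shows "(\<integral>y. h y \<partial>extended_empirical n x z) = (\<Sum>k=1..n+1. h ((x(n+1 := z)) k)) / real (n + 1)"
  unfolding extended_empirical_eq_distr
  by (subst integral_distr) (use assms in \<open>simp_all add: integral_pmf_of_set\<close>)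

lemma greedy_energy_power2:
  fixes z :: real
  assumes x: "\<And>k. k \<in> {1..n} \<Longrightarrow> x k \<in> {0..1}" and z: "z \<in> {0..1}"
  defines "a \<equiv> x(n+1 := z)"
  shows "(greedy_energy n x z)\<^sup>2 = (\<Sum>k=1..n+1. (a k)\<^sup>2) / real (n + 1) + 1/3
     - (\<Sum>i=1..n+1. \<Sum>j=1..n+1. max (a i) (a j)) / (real (n + 1))\<^sup>2"
proof -
  interpret U: prob_space unit_lebesgue by (rule prob_space_unit_lebesgue)
  interpret M: real_distribution "extended_empirical n x z"
    by (rule real_distribution.intro[OF prob_space_extended_empirical]) (unfold_locales, simp)
  define m where "m = real (n + 1)"
  have m: "m > 0" by (simp add: m_def)
  have a01: "0 \<le> a k \<and> a k \<le> 1" if "k \<in> {1..n+1}" for k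
    using that x[of k] z by (auto simp: a_def)
  have 1: "AE y in extended_empirical n x z. y \<in> {0..1}"
    unfolding extended_empirical_eq_distr
    by (subst AE_distr_iff) (use a01 in \<open>auto simp: AE_measure_pmf_iff a_def\<close>)
  have cdf: "cdf (extended_empirical n x z) s = (\<Sum>k=1..n+1. indicator {a k..} s) / m" for s
  proof -
    have "cdf (extended_empirical n x z) s = (\<integral>y. indicator {..s} y \<partial>extended_empirical n x z)"
      by (simp add: cdf_def)
    also have "\<dots> = (\<Sum>k=1..n+1. indicator {..s} (a k)) / m"
      by (simp only: integral_extended_empirical borel_measurable_indicator atMost_borel a_def m_def)
    finally show ?thesis by (simp add: indicator_def)
  qed
  have "(cdf (extended_empirical n x z) s)\<^sup>2 =
      (\<Sum>i=1..n+1. \<Sum>j=1..n+1. indicator {max (a i) (a j)..} s) / m\<^sup>2" for s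
  proof -
    \<comment> \<open>The half-lines starting at \<open>a i\<close> and \<open>a j\<close> intersect
      in the one starting at their maximum.\<close>
    have "(\<Sum>k=1..n+1. indicator {a k..} s)\<^sup>2 =
        (\<Sum>i=1..n+1. \<Sum>j=1..n+1. indicator {max (a i) (a j)..} s :: real)"
      unfolding power2_eq_square sum_product by (intro sum.cong) (auto simp: indicator_def)
    then show ?thesis by (simp only: cdf power_divide)
  qed
  moreover have "integrable unit_lebesgue (indicator {c..} :: real \<Rightarrow> real)" for c
    by (intro U.integrable_const_bound[of _ 1]) (auto simp: indicator_def)
  ultimately have "(\<integral>s. (cdf (extended_empirical n x z) s)\<^sup>2 \<partial>unit_lebesgue) =
      (\<Sum>i=1..n+1. \<Sum>j=1..n+1. measure unit_lebesgue {max (a i) (a j)..}) / m\<^sup>2"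
    by (simp add: Bochner_Integration.integral_sum del: sum.cl_ivl_Suc)
  also have "\<dots> = (\<Sum>i=1..n+1. \<Sum>j=1..n+1. 1 - max (a i) (a j)) / m\<^sup>2"
    using a01 by (intro arg_cong2[where f="(/)"] sum.cong refl measure_unit_lebesgue_atLeast)
      (auto simp: le_max_iff_disj)
  \<comment> \<open>The \<open>m\<^sup>2\<close> ones contribute 1, which turns the constant
    \<open>-2/3\<close> into \<open>1/3\<close>.\<close>
  also have "\<dots> = 1 - (\<Sum>i=1..n+1. \<Sum>j=1..n+1. max (a i) (a j)) / m\<^sup>2"
    using m by (simp add: sum_subtractf diff_divide_distrib power2_eq_square m_def del: sum.cl_ivl_Suc)
  finally show ?thesis
    unfolding greedy_energy_def W2_unit_lebesgue[OF M.real_distribution_axioms 1]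
    by (simp add: integral_extended_empirical a_def m_def del: sum.cl_ivl_Suc)
qed

text \<open>The bracket is free of \<open>z\<close>, so on the unit interval the squared energy is
  an increasing affine function of the Kritzinger functional.\<close>

lemma greedy_energy_kritzinger_fun:
  assumes "\<And>k. k \<in> {1..n} \<Longrightarrow> x k \<in> {0..1}" and "z \<in> {0..1}"
  shows "(greedy_energy n x z)\<^sup>2 = kritzinger_fun n x z / (real (n + 1))\<^sup>2
     + ((\<Sum>k=1..n. (x k)\<^sup>2) / real (n + 1) + 1/3
        - (\<Sum>i=1..n. \<Sum>j=1..n. max (x i) (x j)) / (real (n + 1))\<^sup>2)"
proof -
  define m where "m = real (n + 1)"
  have m: "m > 0" by (simp add: m_def)
  define S P where "S = (\<Sum>k=1..n. (x k)\<^sup>2)" and "P = (\<Sum>i=1..n. \<Sum>j=1..n. max (x i) (x j))"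
  define K where "K = (\<Sum>k=1..n. max (x k) z)"
  have "(\<Sum>k=1..n+1. ((x(n+1 := z)) k)\<^sup>2) = S + z\<^sup>2"
    by (simp add: S_def)
  \<comment> \<open>The last row and the last column contribute \<open>K\<close> each, and the
    corner contributes \<open>z\<close>.\<close>
  moreover have "(\<Sum>i=1..n+1. \<Sum>j=1..n+1. max ((x(n+1 := z)) i) ((x(n+1 := z)) j)) = P + 2 * K + z"
    by (simp add: P_def K_def sum.distrib max.commute[of z])
  ultimately have "(greedy_energy n x z)\<^sup>2 = (S + z\<^sup>2) / m + 1/3 - (P + 2 * K + z) / m\<^sup>2"
    using greedy_energy_power2[of n x z, OF assms] by (simp only: m_def)
  \<comment> \<open>Writing \<open>z\<^sup>2 / m\<close> as \<open>m * z\<^sup>2 / m\<^sup>2\<close>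
    collects the terms in \<open>z\<close> over \<open>m\<^sup>2\<close>.\<close>
  then show ?thesis
    unfolding kritzinger_fun_def m_def[symmetric] S_def[symmetric] P_def[symmetric] K_def[symmetric]
    using m by (simp add: add_divide_distrib diff_divide_distrib power2_eq_square)
qed

lemma greedy_energy_nonneg: "0 \<le> greedy_energy n x z"
  by (simp add: greedy_energy_def W2_def)

text \<open>\<open>is_arg_min\<close> forbids strictly smaller values, so it suffices that both
  functions order points of the unit interval alike. Squaring preserves the order since the energy
  is nonnegative.\<close>

lemma global_minimizer_greedy_energy_iff:
  assumes "\<And>k. k \<in> {1..n} \<Longrightarrow> x k \<in> {0..1}"
  shows "global_minimizer (greedy_energy n x) z \<longleftrightarrow> global_minimizer (kritzinger_fun n x) z"
proof -
  have "greedy_energy n x y < greedy_energy n x z \<longleftrightarrow> kritzinger_fun n x y < kritzinger_fun n x z"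
    if "y \<in> {0..1}" "z \<in> {0..1}" for y z
  proof -
    have "greedy_energy n x y < greedy_energy n x z \<longleftrightarrow> (greedy_energy n x y)\<^sup>2 < (greedy_energy n x z)\<^sup>2"
      by (simp add: power_mono_iff greedy_energy_nonneg flip: not_le)
    also have "\<dots> \<longleftrightarrow> kritzinger_fun n x y < kritzinger_fun n x z"
      using greedy_energy_kritzinger_fun[of n x, OF assms that(1)]
        greedy_energy_kritzinger_fun[of n x, OF assms that(2)]
      by (simp add: divide_less_cancel)
    finally show ?thesis .
  qed
  then show ?thesis
    by (auto simp: global_minimizer_def is_arg_min_def)
qed

theorem theorem1:
  "(\<forall>(n::nat) (x::nat \<Rightarrow> real). n \<ge> 1 \<longrightarrow> (\<forall>k\<in>{1..n}. x k \<in> {0..1}) \<longrightarrow>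
      (\<forall>z\<in>{0..1}. global_minimizer (greedy_energy n x) z \<longleftrightarrow>
                   global_minimizer (kritzinger_fun n x) z))
   \<and> (\<forall>(n0::nat) (x::nat \<Rightarrow> real). n0 \<ge> 1 \<longrightarrow> greedy_W2_from n0 x \<longrightarrow>
        kritzinger_sequence x \<and>
        (\<forall>n\<ge>n0. global_minimizer (kritzinger_fun n x) (x (n + 1))))"
proof -
  have iff: "global_minimizer (greedy_energy n x) z \<longleftrightarrow> global_minimizer (kritzinger_fun n x) z"
    if "\<forall>k\<in>{1..n}. x k \<in> {0..1}" for n x z
    using that by (intro global_minimizer_greedy_energy_iff) blast
  \<comment> \<open>The equivalence is applied at every \<open>n \<ge> n0\<close> with candidate
    \<open>x (n + 1)\<close>, so the same \<open>n0\<close> serves as witness.\<close>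
  have "kritzinger_from n0 x" if "greedy_W2_from n0 x" for n0 x
    using that iff unfolding greedy_W2_from_def kritzinger_from_def by auto
  then show ?thesis
    using iff unfolding kritzinger_sequence_def by (auto simp: kritzinger_from_def)
qed

end
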